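(* Let $G=G(V,E)$ be a connected simple graph with $|V|=n$, and let $(O_t)_{t\ge0}$ be the Sliding-$(n+1)$ stochastic process on the acyclic orientations of $G_{\mathbf{r}}$. Let $S_{\mathbf{r}}$ be the set of acyclic orientations of $G_{\mathbf{r}}$ whose unique maximal element is $\mathbf{r}$. Then $\sum_{t\ge1}\mathbb{P}(O_t\in S_{\mathbf{r}})=\infty$, and for every $O\in S_{\mathbf{r}}$, $$\lim_{N\to\infty}\frac{\sum_{t=1}^N\mathbb{P}(O_t=O)}{\sum_{t=1}^N\mathbb{P}(O_t\in S_{\mathbf{r}})}=\frac{e(O|_V)}{n!},$$ where $O|_V$ is the restriction of $O$ to $E$ (an acyclic orientation of $G$). These results hold independently of the initial choice.
   Context: $G_{\mathbf{r}}$ is the graph on $V\sqcup\{\mathbf{r}\}$ obtained from $G$ by adding a vertex $\mathbf{r}$ adjacent to all vertices of $V$. Sliding-$(n+1)$ process: choose an arbitrary bijection $f_0:V\sqcup\{\mathbf{r}\}\to[n+1]$. For $t\ge1$, let $v_{t-1}$ be the vertex with $f_{t-1}(v_{t-1})=n+1$, choose $v_t$ uniformly at random from the neighbors of $v_{t-1}$ in $G_{\mathbf{r}}$, and let $f_t$ be $f_{t-1}$ with the values at $v_{t-1}$ and $v_t$ swapped. $O_t$ is the acyclic orientation of $G_{\mathbf{r}}$ with edge $\{u,v\}$ oriented $(u,v)$ iff $f_t(u)<f_t(v)$. An acyclic orientation is viewed as the poset it generates ($(u,v)$ meaning $u<v$); $e(\cdot)$ denotes the number of linear extensions, i.e. order-preserving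 bijections onto $[n]$. *)

theory Defs
  imports "HOL-Probability.Probability" "Graph_Theory.Graph_Theory"
begin

text \<open>
  A finite simple graph is a \<^locale>\<open>pair_graph\<close>: an irreflexive symmetric arc set, so the edge
  $\{u,v\}$ is the pair of arcs $(u,v)$, $(v,u)$.
\<close>

text \<open>The vertex set $V \sqcup \{\mathbf{r}\}$ is encoded by the option type, with $\mathbf{r}$ as \<^term>\<open>None\<close>.\<close>

definition add_root :: "'a pair_pre_digraph \<Rightarrow> 'a option pair_pre_digraph" where
  "add_root G =
     \<lparr> pverts = insert None (Some ` pverts G),
       parcs = {(Some u, Some v) | u v. (u, v) \<in> parcs G}
             \<union> {(None, Some v) | v. v \<in> pverts G}
             \<union> {(Some v, None) | v. v \<in> pverts G} \<rparr>"

definition neighbors :: "'a pair_pre_digraph \<Rightarrow> 'a \<Rightarrow> 'a set" where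
  "neighbors G v = {w. (v, w) \<in> parcs G}"

definition acyclic_orientation :: "'a pair_pre_digraph \<Rightarrow> 'a rel \<Rightarrow> bool" where
  "acyclic_orientation G D \<longleftrightarrow>
     D \<subseteq> parcs G \<and> (\<forall>(u, v) \<in> parcs G. (u, v) \<in> D \<longleftrightarrow> (v, u) \<notin> D) \<and> acyclic D"

definition generated_order :: "'a set \<Rightarrow> 'a rel \<Rightarrow> 'a rel" where
  "generated_order V D = Restr (D\<^sup>*) V"

definition maximal_elements :: "'a set \<Rightarrow> 'a rel \<Rightarrow> 'a set" where
  "maximal_elements V P = {x \<in> V. \<forall>y \<in> V. (x, y) \<in> P \<longrightarrow> y = x}"

text \<open>
  Bijections are taken extensional (undefined outside \<^term>\<open>V\<close>), so that each one is counted once.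
\<close>

definition linear_extensions :: "'a set \<Rightarrow> 'a rel \<Rightarrow> ('a \<Rightarrow> nat) set" where
  "linear_extensions V P =
     {g \<in> V \<rightarrow>\<^sub>E {1..card V}. bij_betw g V {1..card V} \<and> (\<forall>(x, y) \<in> P. g x \<le> g y)}"

definition num_linear_extensions :: "'a pair_pre_digraph \<Rightarrow> 'a rel \<Rightarrow> nat" where
  "num_linear_extensions G D =
     card (linear_extensions (pverts G) (generated_order (pverts G) D))"

definition root_maximal_orientations :: "'a pair_pre_digraph \<Rightarrow> 'a option rel set" where
  "root_maximal_orientations G =
     {D. acyclic_orientation (add_root G) D \<and>
         maximal_elements (pverts (add_root G)) (generated_order (pverts (add_root G)) D) = {None}}"

definition restrict_orientation :: "'a pair_pre_digraph \<Rightarrow> 'a option rel \<Rightarrow> 'a rel" where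
  "restrict_orientation G D = {(u, v) \<in> parcs G. (Some u, Some v) \<in> D}"

definition induced_orientation :: "'a pair_pre_digraph \<Rightarrow> ('a \<Rightarrow> nat) \<Rightarrow> 'a rel" where
  "induced_orientation H f = {(u, v) \<in> parcs H. f u < f v}"

definition top_vertex :: "'a pair_pre_digraph \<Rightarrow> ('a \<Rightarrow> nat) \<Rightarrow> 'a" where
  "top_vertex H f = (THE v. v \<in> pverts H \<and> f v = card (pverts H))"

definition slide :: "'a pair_pre_digraph \<Rightarrow> ('a \<Rightarrow> nat) \<Rightarrow> ('a \<Rightarrow> nat) pmf" where
  "slide H f = do {
     let v = top_vertex H f;
     w \<leftarrow> pmf_of_set (neighbors H v);
     return_pmf (f(v := f w, w := f v))
   }"

text \<open>
  The law of $f_t$ on a graph \<^term>\<open>H\<close> with $n+1$ vertices, started from the labelling \<^term>\<open>f0\<close>.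
\<close>

primrec sliding_labelling ::
    "'a pair_pre_digraph \<Rightarrow> ('a \<Rightarrow> nat) \<Rightarrow> nat \<Rightarrow> ('a \<Rightarrow> nat) pmf" where
  "sliding_labelling H f0 0 = return_pmf f0"
| "sliding_labelling H f0 (Suc t) = bind_pmf (sliding_labelling H f0 t) (slide H)"

text \<open>The law of $O_t$.\<close>

definition sliding_orientation ::
    "'a pair_pre_digraph \<Rightarrow> ('a option \<Rightarrow> nat) \<Rightarrow> nat \<Rightarrow> 'a option rel pmf" where
  "sliding_orientation G f0 t =
     map_pmf (induced_orientation (add_root G)) (sliding_labelling (add_root G) f0 t)"

lemma pair_graph_add_root:
  assumes "pair_graph G"
  shows "pair_graph (add_root G)"
proof -
  interpret pair_graph G by fact
  have eq: "parcs (add_root G) = (\<lambda>(u, v). (Some u, Some v)) ` parcs G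
      \<union> (\<lambda>v. (None, Some v)) ` pverts G \<union> (\<lambda>v. (Some v, None)) ` pverts G"
    by (auto simp: add_root_def)
  have "finite (parcs (add_root G))"
    unfolding eq by (intro finite_UnI finite_imageI pair_finite_arcs pair_finite_verts)
  moreover have "symmetric (with_proj (add_root G))"
    unfolding symmetric_def sym_def
    by (auto simp: add_root_def intro: arcs_symmetric)
  ultimately show ?thesis
    by unfold_locales
      (auto simp: add_root_def pair_finite_verts dest: in_arcsD1 in_arcsD2 no_loops')
qed

lemma acyclic_orientation_induced:
  assumes "pair_graph H" and "inj_on f (pverts H)"
  shows "acyclic_orientation H (induced_orientation H f)"
proof -
  interpret pair_graph H by fact
  have "f u < f v" if "(u, v) \<in> (induced_orientation H f)\<^sup>+" for u v
    using that by induction (auto simp: induced_orientation_def)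
  then have "acyclic (induced_orientation H f)"
    by (fastforce simp: acyclic_def)
  moreover have "f u < f v \<longleftrightarrow> \<not> f v < f u" if "(u, v) \<in> parcs H" for u v
    using that assms(2) no_loops'[OF that] in_arcsD1[OF that] in_arcsD2[OF that]
    by (metis inj_onD linorder_neqE_nat order_less_asym)
  ultimately show ?thesis
    by (auto simp: acyclic_orientation_def induced_orientation_def dest: arcs_symmetric)
qed

lemma acyclic_orientation_restrict:
  assumes "acyclic_orientation (add_root G) D"
  shows "acyclic_orientation G (restrict_orientation G D)"
proof -
  have "(Some u, Some v) \<in> D\<^sup>+" if "(u, v) \<in> (restrict_orientation G D)\<^sup>+" for u v
    using that
    by induction (auto simp: restrict_orientation_def intro: trancl_into_trancl)
  then have "acyclic (restrict_orientation G D)"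
    using assms unfolding acyclic_orientation_def acyclic_def by blast
  moreover have "(v, u) \<in> parcs G" if "(Some v, Some u) \<in> D" for u v
    using that assms by (auto simp: acyclic_orientation_def add_root_def)
  moreover have "(Some u, Some v) \<in> D \<longleftrightarrow> (Some v, Some u) \<notin> D" if "(u, v) \<in> parcs G" for u v
  proof -
    have "(Some u, Some v) \<in> parcs (add_root G)"
      using that by (simp add: add_root_def)
    then show ?thesis
      using assms unfolding acyclic_orientation_def by fast
  qed
  ultimately show ?thesis
    unfolding acyclic_orientation_def restrict_orientation_def by auto
qed

end

theory Submission
  imports Defs
begin

text \<open>
  The labelling process is the simple random walk on a finite graph whose vertices are the
  labellings of $G_{\mathbf{r}}$. For a simple random walk the expected number of visits to $x$ up
  to time $N$, divided by the degree of $x$, has a graph Laplacian bounded by 1, because the sum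
  over time telescopes; on a finite connected graph a function with bounded Laplacian has bounded
  oscillation. As the total number of visits is $N$, these functions tend to infinity, and their
  ratios tend to 1. All labellings with the top label at $\mathbf{r}$ have degree $n$, so they are
  visited equally often in the limit. There are $n!$ of them, and those inducing the orientation
  $O$ are the linear extensions of $O|_V$. The graph of labellings is connected because moving the
  top label around a triangle through $\mathbf{r}$ swaps the labels of two adjacent vertices.
\<close>

subsection \<open>Simple random walks on finite connected graphs\<close>

text \<open>Periodicity is allowed, and it occurs below: every slide composes a labelling with a
  transposition and so changes its parity. Hence only time averages are studied.\<close>

locale finite_random_walk =
  fixes S :: "'s set" and nb :: "'s \<Rightarrow> 's set" and K :: "'s \<Rightarrow> 's pmf" and \<mu> :: "nat \<Rightarrow> 's pmf"
  assumes finite_S: "finite S"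
    and nb_subset: "x \<in> S \<Longrightarrow> nb x \<subseteq> S"
    and nb_nonempty: "x \<in> S \<Longrightarrow> nb x \<noteq> {}"
    and nb_sym: "x \<in> S \<Longrightarrow> y \<in> nb x \<Longrightarrow> x \<in> nb y"
    and nb_connected: "x \<in> S \<Longrightarrow> y \<in> S \<Longrightarrow> (x, y) \<in> {(x, y). x \<in> S \<and> y \<in> nb x}\<^sup>*"
    and K_eq: "x \<in> S \<Longrightarrow> K x = pmf_of_set (nb x)"
    and start: "set_pmf (\<mu> 0) \<subseteq> S"
    and step: "\<mu> (Suc t) = bind_pmf (\<mu> t) K"
begin

section \<open>One-step law of the walk\<close>

lemma finite_nb: "x \<in> S \<Longrightarrow> finite (nb x)"
  using finite_S nb_subset finite_subset by blast

lemma degree_pos: "x \<in> S \<Longrightarrow> 0 < card (nb x)"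
  using finite_nb nb_nonempty by (simp add: card_gt_0_iff)

lemma set_pmf_walk: "set_pmf (\<mu> t) \<subseteq> S"
proof (induction t)
  case (Suc t)
  have "set_pmf (K x) \<subseteq> S" if "x \<in> S" for x
    using that nb_subset finite_nb nb_nonempty by (simp add: K_eq)
  with Suc show ?case by (auto simp: step)
qed (rule start)

lemma prob_walk: "B \<subseteq> S \<Longrightarrow> measure_pmf.prob (\<mu> t) B = (\<Sum>x\<in>B. pmf (\<mu> t) x)"
  by (simp add: measure_measure_pmf_finite finite_subset[OF _ finite_S])

text \<open>By symmetry the states that can step to \<open>x\<close> are exactly its neighbours, and
  each neighbour \<open>y\<close> does so with probability 1 over its own degree.\<close>

lemma pmf_walk_Suc:
  assumes "x \<in> S"
  shows "pmf (\<mu> (Suc t)) x = (\<Sum>y\<in>nb x. pmf (\<mu> t) y / card (nb y))"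
proof -
  have "pmf (\<mu> (Suc t)) x = (\<Sum>y\<in>S. pmf (\<mu> t) y * pmf (K y) x)"
    unfolding step pmf_bind
    by (subst integral_measure_pmf_real[OF finite_S])
      (use set_pmf_walk in \<open>auto simp: mult.commute\<close>)
  also have "\<dots> = (\<Sum>y\<in>S. if y \<in> nb x then pmf (\<mu> t) y / card (nb y) else 0)"
  proof (intro sum.cong refl)
    fix y assume "y \<in> S"
    moreover from this have "x \<in> nb y \<longleftrightarrow> y \<in> nb x"
      using assms nb_sym by blast
    ultimately show "pmf (\<mu> t) y * pmf (K y) x = (if y \<in> nb x then pmf (\<mu> t) y / card (nb y) else 0)"
      by (simp add: K_eq pmf_of_set finite_nb nb_nonempty)
  qed
  also have "\<dots> = (\<Sum>y\<in>nb x. pmf (\<mu> t) y / card (nb y))"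
    using nb_subset[OF assms] finite_S by (simp add: sum.inter_restrict[symmetric] Int_absorb1)
  finally show ?thesis .
qed

section \<open>Expected visits and bounded oscillation\<close>

definition visits :: "nat \<Rightarrow> 's \<Rightarrow> real" where
  "visits N x = (\<Sum>t=1..N. pmf (\<mu> t) x)"

text \<open>A truncated Green function, normalised by the reversing measure of the walk.\<close>

definition potential :: "nat \<Rightarrow> 's \<Rightarrow> real" where
  "potential N x = visits N x / card (nb x)"

lemma sum_prob_eq_visits:
  assumes "B \<subseteq> S"
  shows "(\<Sum>t=1..N. measure_pmf.prob (\<mu> t) B) = (\<Sum>x\<in>B. visits N x)"
  unfolding visits_def by (simp add: prob_walk[OF assms]) (rule sum.swap)

lemma sum_visits: "(\<Sum>x\<in>S. visits N x) = N"
proof -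
  have "measure_pmf.prob (\<mu> t) S = 1" for t
    using set_pmf_walk by (simp add: measure_pmf.prob_eq_1 AE_measure_pmf_iff subset_iff)
  then show ?thesis
    by (simp flip: sum_prob_eq_visits)
qed

lemma visits_eq: "x \<in> S \<Longrightarrow> visits N x = card (nb x) * potential N x"
  using degree_pos[of x] by (simp add: potential_def)

text \<open>Reversibility makes the sum over time telescope.\<close>

lemma potential_laplacian:
  assumes "x \<in> S"
  shows "(\<Sum>y\<in>nb x. potential N x - potential N y) \<le> 1"
proof -
  \<comment> \<open>The denominator \<open>card (nb y)\<close> supplies the step probability, so the
    neighbours of \<open>x\<close> together count the visits to \<open>x\<close> one time step
    later.\<close>
  have "(\<Sum>y\<in>nb x. potential N y) = (\<Sum>t=1..N. pmf (\<mu> (Suc t)) x)"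
    unfolding potential_def visits_def sum_divide_distrib
    by (subst sum.swap) (simp add: pmf_walk_Suc[OF assms])
  moreover have "(\<Sum>t=1..N. pmf (\<mu> t) x) - (\<Sum>t=1..N. pmf (\<mu> (Suc t)) x) = pmf (\<mu> 1) x - pmf (\<mu> (Suc N)) x"
    by (induction N) auto
  moreover have "(\<Sum>y\<in>nb x. potential N x) = (\<Sum>t=1..N. pmf (\<mu> t) x)"
    using visits_eq[OF assms] by (simp add: visits_def)
  moreover have "pmf (\<mu> 1) x - pmf (\<mu> (Suc N)) x \<le> 1"
    using pmf_le_1[of "\<mu> 1" x] pmf_nonneg[of "\<mu> (Suc N)" x] by linarith
  ultimately show ?thesis
    by (simp only: sum_subtractf)
qed

text \<open>
  A quantitative maximum principle: a bound on the gap to the maximum at a vertex bounds it at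
  every neighbour.
\<close>

lemma gap_from_maximum:
  assumes "(x, z) \<in> {(x, y). x \<in> S \<and> y \<in> nb x}\<^sup>*" and "x \<in> S"
  shows "\<exists>C. \<forall>h :: 's \<Rightarrow> real. (\<forall>y\<in>S. h y \<le> h x) \<longrightarrow>
    (\<forall>y\<in>S. (\<Sum>w\<in>nb y. h y - h w) \<le> 1) \<longrightarrow> h x - h z \<le> C"
  using assms(1)
proof induction
  case base
  show ?case by (intro exI[of _ 0]) simp
next
  case (step y z)
  then obtain C where C: "\<And>h :: 's \<Rightarrow> real. \<forall>y\<in>S. h y \<le> h x \<Longrightarrow>
      \<forall>y\<in>S. (\<Sum>w\<in>nb y. h y - h w) \<le> 1 \<Longrightarrow> h x - h y \<le> C"
    by blast
  from step have y: "y \<in> S" and z: "z \<in> nb y" by auto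
  show ?case
  proof (intro exI allI impI)
    fix h :: "'s \<Rightarrow> real"
    assume max: "\<forall>y\<in>S. h y \<le> h x" and lap: "\<forall>y\<in>S. (\<Sum>w\<in>nb y. h y - h w) \<le> 1"
    have gap: "h x - h y \<le> C" using C[OF max lap] .
    \<comment> \<open>As \<open>h x\<close> is maximal, no neighbour of \<open>y\<close> exceeds
      \<open>h y\<close> by more than \<open>C\<close>. Only these limited rises can offset a drop
      from \<open>y\<close> to \<open>z\<close>, up to the Laplacian bound 1.\<close>
    have "- C * card (nb y - {z}) \<le> (\<Sum>w\<in>nb y - {z}. h y - h w)"
    proof -
      have "- C \<le> h y - h w" if "w \<in> nb y - {z}" for w
        using that y nb_subset max gap by fastforce
      then show ?thesis
        using sum_bounded_below[of "nb y - {z}" "- C" "\<lambda>w. h y - h w"] by (simp add: mult.commute)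
    qed
    moreover have "(\<Sum>w\<in>nb y. h y - h w) = (h y - h z) + (\<Sum>w\<in>nb y - {z}. h y - h w)"
      using finite_nb[OF y] z by (rule sum.remove)
    moreover have "(\<Sum>w\<in>nb y. h y - h w) \<le> 1" using lap y by blast
    ultimately show "h x - h z \<le> C + 1 + C * card (nb y - {z})"
      using gap by linarith
  qed
qed

text \<open>The constants from \<open>gap_from_maximum\<close> depend on the two vertices but not on
  the function, so their maximum over the finite set of pairs serves all \<open>N\<close> at once,
  wherever \<open>potential N\<close> is largest.\<close>

lemma bounded_oscillation: "\<exists>C. \<forall>N. \<forall>x\<in>S. \<forall>z\<in>S. potential N x - potential N z \<le> C"
proof -
  have "\<exists>C. \<forall>p\<in>S \<times> S. \<forall>h :: 's \<Rightarrow> real. (\<forall>y\<in>S. h y \<le> h (fst p)) \<longrightarrow>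
      (\<forall>y\<in>S. (\<Sum>w\<in>nb y. h y - h w) \<le> 1) \<longrightarrow> h (fst p) - h (snd p) \<le> C p"
  proof (intro bchoice ballI)
    fix p assume "p \<in> S \<times> S"
    then have "fst p \<in> S" and "snd p \<in> S" by auto
    then show "\<exists>C. \<forall>h :: 's \<Rightarrow> real. (\<forall>y\<in>S. h y \<le> h (fst p)) \<longrightarrow>
        (\<forall>y\<in>S. (\<Sum>w\<in>nb y. h y - h w) \<le> 1) \<longrightarrow> h (fst p) - h (snd p) \<le> C"
      by (intro gap_from_maximum nb_connected)
  qed
  then obtain C where C: "\<forall>p\<in>S \<times> S. \<forall>h :: 's \<Rightarrow> real. (\<forall>y\<in>S. h y \<le> h (fst p)) \<longrightarrow>
      (\<forall>y\<in>S. (\<Sum>w\<in>nb y. h y - h w) \<le> 1) \<longrightarrow> h (fst p) - h (snd p) \<le> C p"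
    by (rule exE)
  have "potential N x - potential N z \<le> Max (C ` (S \<times> S))" if x: "x \<in> S" and z: "z \<in> S" for N x z
  proof -
    have "Max (potential N ` S) \<in> potential N ` S"
      using finite_S x by (intro Max_in) auto
    then obtain m where "m \<in> S" "potential N m = Max (potential N ` S)" by force
    with finite_S have m: "m \<in> S" "\<forall>y\<in>S. potential N y \<le> potential N m" by auto
    then have "potential N m - potential N z \<le> C (m, z)"
      using C[rule_format, of "(m, z)" "potential N"] z potential_laplacian by simp
    also have "\<dots> \<le> Max (C ` (S \<times> S))"
      using m(1) z finite_S by (intro Max_ge) auto
    finally show ?thesis using m(2) x by fastforce
  qed
  then show ?thesis by blast
qed

section \<open>Limits of visit counts\<close>

lemma potential_at_top:
  assumes "x \<in> S"
  shows "filterlim (\<lambda>N. potential N x) at_top sequentially"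
proof -
  obtain C where C: "\<And>N x z. x \<in> S \<Longrightarrow> z \<in> S \<Longrightarrow> potential N x - potential N z \<le> C"
    using bounded_oscillation by blast
  define d where "d = (\<Sum>y\<in>S. real (card (nb y)))"
  have "0 < d"
    unfolding d_def using assms finite_S degree_pos by (intro sum_pos) auto
  \<comment> \<open>All \<open>N\<close> visits are shared among finitely many states whose
    potentials differ by at most \<open>C\<close>; weighted by degree, of total \<open>d\<close>,
    the potentials add up to \<open>N\<close>.\<close>
  have "real N / d - C \<le> potential N x" for N
  proof -
    have "real N = (\<Sum>y\<in>S. card (nb y) * potential N y)"
      using sum_visits[of N] by (simp add: visits_eq)
    also have "\<dots> \<le> (\<Sum>y\<in>S. card (nb y) * (potential N x + C))"
    proof (intro sum_mono mult_left_mono)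
      fix y assume "y \<in> S"
      with C[OF this assms, of N] show "potential N y \<le> potential N x + C" by linarith
    qed simp
    also have "\<dots> = d * (potential N x + C)"
      by (simp add: d_def sum_distrib_right)
    finally show ?thesis
      using \<open>0 < d\<close> by (simp add: field_simps)
  qed
  moreover have "filterlim (\<lambda>N. real N / d - C) at_top sequentially"
    using \<open>0 < d\<close> by real_asymp
  ultimately show ?thesis
    by (auto intro: filterlim_at_top_mono)
qed

text \<open>The difference of the two potentials stays bounded while the denominator
  diverges.\<close>

lemma potential_ratio:
  assumes "x \<in> S" and "y \<in> S"
  shows "(\<lambda>N. potential N y / potential N x) \<longlonglongrightarrow> 1"
proof -
  obtain C where C: "\<And>N x z. x \<in> S \<Longrightarrow> z \<in> S \<Longrightarrow> potential N x - potential N z \<le> C"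
    using bounded_oscillation by blast
  have bound: "\<bar>potential N y - potential N x\<bar> \<le> C" for N
    using C[OF assms, of N] C[OF assms(2,1), of N] by linarith
  have pos: "\<forall>\<^sub>F N in sequentially. 0 < potential N x"
    using potential_at_top[OF assms(1)] by (simp add: filterlim_at_top_dense)
  have "(\<lambda>N. C / potential N x) \<longlonglongrightarrow> 0"
    using potential_at_top[OF assms(1)]
    by (intro tendsto_divide_0[OF tendsto_const] filterlim_at_top_imp_at_infinity)
  then have "(\<lambda>N. potential N y / potential N x - 1) \<longlonglongrightarrow> 0"
  proof (rule Lim_null_comparison[rotated])
    show "\<forall>\<^sub>F N in sequentially. norm (potential N y / potential N x - 1) \<le> C / potential N x"
      using pos
    proof eventually_elim
      case (elim N)
      then have "potential N y / potential N x - 1 = (potential N y - potential N x) / potential N x"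
        by (simp add: field_simps)
      with elim bound[of N] show ?case
        by (simp add: abs_divide divide_right_mono)
    qed
  qed
  then show ?thesis by (simp add: LIM_zero_iff)
qed

lemma expected_visits_at_top:
  assumes "x \<in> S"
  shows "filterlim (\<lambda>N. visits N x) at_top sequentially"
  using filterlim_tendsto_pos_mult_at_top[OF tendsto_const _ potential_at_top[OF assms], of "card (nb x)"]
    degree_pos[OF assms] by (simp add: visits_eq[OF assms])

text \<open>The invariant measure is proportional to the degree, hence uniform on sets of constant degree.\<close>

lemma visits_ratio:
  assumes "A \<subseteq> S" and "A \<noteq> {}" and "B \<subseteq> A" and deg: "\<And>x. x \<in> A \<Longrightarrow> card (nb x) = d"
  shows "(\<lambda>N. (\<Sum>t=1..N. measure_pmf.prob (\<mu> t) B) / (\<Sum>t=1..N. measure_pmf.prob (\<mu> t) A))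
    \<longlonglongrightarrow> card B / card A"
proof -
  \<comment> \<open>The state \<open>a\<close> only sets the scale: divided by
    \<open>potential N a\<close>, each potential tends to 1.\<close>
  obtain a where a: "a \<in> A" using assms(2) by blast
  with assms have aS: "a \<in> S" by blast
  have "0 < d" using degree_pos[OF aS] deg[OF a] by simp
  have "finite A" using assms finite_S finite_subset by blast
  have pos: "\<forall>\<^sub>F N in sequentially. 0 < potential N a"
    using potential_at_top[OF aS] by (simp add: filterlim_at_top_dense)
  have sum: "(\<lambda>N. (\<Sum>x\<in>X. potential N x / potential N a)) \<longlonglongrightarrow> card X" if "X \<subseteq> A" for X
  proof -
    have "(\<lambda>N. (\<Sum>x\<in>X. potential N x / potential N a)) \<longlonglongrightarrow> (\<Sum>x\<in>X. 1)"
      using that assms(1) aS by (intro tendsto_sum potential_ratio) auto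
    then show ?thesis by simp
  qed
  have "(\<lambda>N. (\<Sum>x\<in>B. potential N x / potential N a) / (\<Sum>x\<in>A. potential N x / potential N a))
    \<longlonglongrightarrow> card B / card A"
    using sum[OF assms(3)] sum[OF subset_refl] \<open>finite A\<close> assms(2) by (intro tendsto_divide) auto
  \<comment> \<open>Constant degree turns visits into \<open>d\<close> times potentials; the factors
    \<open>d\<close> and \<open>potential N a\<close> cancel once the latter is positive.\<close>
  moreover have "\<forall>\<^sub>F N in sequentially.
      (\<Sum>x\<in>B. potential N x / potential N a) / (\<Sum>x\<in>A. potential N x / potential N a)
      = (\<Sum>t=1..N. measure_pmf.prob (\<mu> t) B) / (\<Sum>t=1..N. measure_pmf.prob (\<mu> t) A)"
    using pos
  proof eventually_elim
    case (elim N)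
    have "(\<Sum>t=1..N. measure_pmf.prob (\<mu> t) X) = d * (\<Sum>x\<in>X. potential N x)" if "X \<subseteq> A" for X
    proof -
      have "(\<Sum>x\<in>X. visits N x) = (\<Sum>x\<in>X. d * potential N x)"
        using that assms(1) deg by (intro sum.cong) (auto simp: visits_eq subset_iff)
      then show ?thesis
        using that assms(1) sum_prob_eq_visits[of X N] by (simp add: sum_distrib_left)
    qed
    with assms(3) elim \<open>0 < d\<close> show ?case
      by (simp flip: sum_divide_distrib)
  qed
  ultimately show ?thesis
    by (rule Lim_transform_eventually)
qed

text \<open>Convergence would pass to a single state of \<open>A\<close>, but there the partial sums
  are expected visits, which diverge.\<close>

lemma suminf_prob:
  assumes "A \<subseteq> S" and "A \<noteq> {}"
  shows "(\<Sum>t. ennreal (measure_pmf.prob (\<mu> (t + 1)) A)) = \<infinity>"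
proof (rule ccontr)
  obtain a where a: "a \<in> A" using assms(2) by blast
  with assms have aS: "a \<in> S" by blast
  assume "(\<Sum>t. ennreal (measure_pmf.prob (\<mu> (t + 1)) A)) \<noteq> \<infinity>"
  then have "summable (\<lambda>t. measure_pmf.prob (\<mu> (t + 1)) A)"
    by (intro summable_suminf_not_top) auto
  then have "summable (\<lambda>t. pmf (\<mu> (t + 1)) a)"
    by (rule summable_comparison_test'[of _ 0])
      (use a in \<open>auto simp: measure_pmf_single[symmetric] intro!: measure_pmf.finite_measure_mono\<close>)
  then have "convergent (\<lambda>N. \<Sum>t<N. pmf (\<mu> (t + 1)) a)"
    by (simp add: summable_iff_convergent)
  moreover have "(\<Sum>t<N. pmf (\<mu> (t + 1)) a) = visits N a" for N
    unfolding visits_def by (simp add: sum.atLeast1_atMost_eq)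
  ultimately show False
    using expected_visits_at_top[OF aS] 
    by (metis (no_types, lifting) convergent_def not_tendsto_and_filterlim_at_infinity
        filterlim_at_top_imp_at_infinity ext trivial_limit_sequentially)
qed

end

subsection \<open>The graph of labellings\<close>

locale rooted_sliding =
  fixes G :: "'a pair_pre_digraph" and f0 :: "'a option \<Rightarrow> nat"
  assumes graph: "pair_graph G"
    and graph_connected: "Digraph_Component.connected (with_proj G)"
    and start_bij: "bij_betw f0 (pverts (add_root G)) {1..card (pverts (add_root G))}"
begin

abbreviation V :: "'a set" where "V \<equiv> pverts G"
abbreviation H :: "'a option pair_pre_digraph" where "H \<equiv> add_root G"
abbreviation W :: "'a option set" where "W \<equiv> pverts H"

text \<open>Slides never touch values outside \<open>W\<close>; prescribing them by
  \<open>f0\<close> makes the state space finite and lists each bijection once.\<close>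

definition labellings :: "('a option \<Rightarrow> nat) set" where
  "labellings = {f. bij_betw f W {1..card W} \<and> (\<forall>x. x \<notin> W \<longrightarrow> f x = f0 x)}"

definition root_top_labellings :: "('a option \<Rightarrow> nat) set" where
  "root_top_labellings = {f \<in> labellings. f None = card W}"

text \<open>Precomposing with a transposition equals the double update in \<open>slide\<close> and
  brings in the algebra of permutations.\<close>

definition slides :: "('a option \<Rightarrow> nat) \<Rightarrow> ('a option \<Rightarrow> nat) set" where
  "slides f = (\<lambda>w. f \<circ> Transposition.transpose (top_vertex H f) w) ` neighbors H (top_vertex H f)"

definition moves :: "('a option \<Rightarrow> nat) rel" where
  "moves = {(f, g). f \<in> labellings \<and> g \<in> slides f}"

interpretation pair_graph G
  by (rule graph)

interpretation rooted: pair_graph H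
  by (rule pair_graph_add_root[OF graph])

section \<open>Basic facts about the rooted graph and its labellings\<close>

lemma finite_V: "finite V"
  by (rule pair_finite_verts)

lemma W_eq: "W = insert None (Some ` V)"
  by (simp add: add_root_def)

lemma finite_W: "finite W"
  using finite_V by (simp add: W_eq)

lemma card_W: "card W = Suc (card V)"
  using finite_V by (simp add: W_eq card_image)

lemma None_in_W: "None \<in> W"
  by (simp add: W_eq)

lemma V_nonempty: "V \<noteq> {}"
  using graph_connected by (simp add: Digraph_Component.connected_def strongly_connected_def)

lemma arcs_H_sym: "(v, w) \<in> parcs H \<Longrightarrow> (w, v) \<in> parcs H"
  by (rule rooted.arcs_symmetric)

lemma arcs_H_in_W: "(v, w) \<in> parcs H \<Longrightarrow> v \<in> W \<and> w \<in> W"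
  using rooted.in_arcsD1 rooted.in_arcsD2 by blast

lemma neighbors_None: "neighbors H None = Some ` V"
  by (auto simp: neighbors_def add_root_def)

lemma neighbors_subset: "neighbors H v \<subseteq> W"
  using arcs_H_in_W by (auto simp: neighbors_def)

lemma finite_neighbors: "finite (neighbors H v)"
  using finite_W neighbors_subset finite_subset by blast

lemma neighbors_nonempty: "v \<in> W \<Longrightarrow> neighbors H v \<noteq> {}"
  using V_nonempty by (auto simp: neighbors_def add_root_def)

lemma labelling_bij: "f \<in> labellings \<Longrightarrow> bij_betw f W {1..card W}"
  by (simp add: labellings_def)

lemma labelling_range: "f \<in> labellings \<Longrightarrow> x \<in> W \<Longrightarrow> f x \<in> {1..card W}"
  using labelling_bij bij_betwE by blast

lemma labelling_le: "f \<in> labellings \<Longrightarrow> x \<in> W \<Longrightarrow> f x \<le> card W"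
  using labelling_range by fastforce

lemma labelling_inj: "f \<in> labellings \<Longrightarrow> inj_on f W"
  using labelling_bij bij_betw_def by blast

lemma finite_labellings: "finite labellings"
proof (rule finite_imageD)
  show "finite ((\<lambda>f. restrict f W) ` labellings)"
  proof (rule finite_subset)
    show "(\<lambda>f. restrict f W) ` labellings \<subseteq> W \<rightarrow>\<^sub>E {1..card W}"
      using labelling_range by (auto simp del: atLeastAtMost_iff)
    show "finite (W \<rightarrow>\<^sub>E {1..card W})"
      by (intro finite_PiE finite_W) simp
  qed
  show "inj_on (\<lambda>f. restrict f W) labellings"
  proof (intro inj_onI ext)
    fix f g x assume "f \<in> labellings" "g \<in> labellings" "restrict f W = restrict g W"
    then show "f x = g x"
      by (cases "x \<in> W") (auto simp: labellings_def dest: fun_cong[of _ _ x])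
  qed
qed

lemma top_vertex_eq:
  assumes "f \<in> labellings" and "v \<in> W" and "f v = card W"
  shows "top_vertex H f = v"
  unfolding top_vertex_def using assms labelling_inj[OF assms(1)]
  by (intro the_equality) (metis inj_onD)+

lemma top_vertex:
  assumes "f \<in> labellings"
  shows "top_vertex H f \<in> W" and "f (top_vertex H f) = card W"
proof -
  have "card W \<in> f ` W"
    using labelling_bij[OF assms] by (simp add: bij_betw_def card_W)
  then obtain v where "v \<in> W" "f v = card W" by force
  with top_vertex_eq[OF assms this] show "top_vertex H f \<in> W" "f (top_vertex H f) = card W"
    by auto
qed

lemma labelling_comp:
  assumes "f \<in> labellings" and "p permutes W"
  shows "f \<circ> p \<in> labellings"
  using assms bij_betw_trans[OF permutes_imp_bij[OF assms(2)] labelling_bij[OF assms(1)]]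
  by (auto simp: labellings_def permutes_not_in)

lemma root_top_comp:
  assumes "f \<in> root_top_labellings" and "p permutes Some ` V"
  shows "f \<circ> p \<in> root_top_labellings"
proof -
  have "p permutes W" by (rule permutes_subset[OF assms(2)]) (auto simp: W_eq)
  moreover have "p None = None" using assms(2) by (auto simp: permutes_not_in)
  ultimately show ?thesis
    using assms(1) labelling_comp by (auto simp: root_top_labellings_def)
qed

section \<open>Sliding as a random walk step\<close>

lemma swap_top:
  assumes "f \<in> labellings" and "w \<in> W"
  shows "f \<circ> Transposition.transpose (top_vertex H f) w \<in> labellings"
    and "top_vertex H (f \<circ> Transposition.transpose (top_vertex H f) w) = w"
proof -
  show *: "f \<circ> Transposition.transpose (top_vertex H f) w \<in> labellings"
    using assms top_vertex by (intro labelling_comp permutes_swap_id) auto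
  show "top_vertex H (f \<circ> Transposition.transpose (top_vertex H f) w) = w"
    using assms top_vertex by (intro top_vertex_eq[OF *]) auto
qed

text \<open>The chosen neighbour is recovered as the new position of the top label. Hence a uniform
  neighbour gives a uniform element of \<open>slides f\<close>.\<close>

lemma inj_on_swap_top:
  assumes "f \<in> labellings"
  shows "inj_on (\<lambda>w. f \<circ> Transposition.transpose (top_vertex H f) w) (neighbors H (top_vertex H f))"
  by (rule inj_on_inverseI[where g = "top_vertex H"])
    (use swap_top(2)[OF assms] neighbors_subset in blast)

lemma card_slides: "f \<in> labellings \<Longrightarrow> card (slides f) = card (neighbors H (top_vertex H f))"
  unfolding slides_def by (intro card_image inj_on_swap_top)

lemma slide_eq:
  assumes "f \<in> labellings"
  shows "slide H f = pmf_of_set (slides f)"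
proof -
  have "f(v := f w, w := f v) = f \<circ> Transposition.transpose v w" for v w
    by (auto simp: fun_eq_iff Transposition.transpose_def)
  then have "slide H f = map_pmf (\<lambda>w. f \<circ> Transposition.transpose (top_vertex H f) w)
      (pmf_of_set (neighbors H (top_vertex H f)))"
    by (simp add: slide_def map_pmf_def Let_def)
  also have "\<dots> = pmf_of_set (slides f)"
    unfolding slides_def
    using assms by (intro map_pmf_of_set_inj inj_on_swap_top neighbors_nonempty top_vertex
        finite_neighbors)
  finally show ?thesis .
qed

lemma slides_subset: "f \<in> labellings \<Longrightarrow> slides f \<subseteq> labellings"
  using swap_top(1) neighbors_subset by (auto simp: slides_def)

text \<open>Sliding the top label back along the same edge undoes the move.\<close>

lemma slides_sym:
  assumes "f \<in> labellings" and "g \<in> slides f"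
  shows "f \<in> slides g"
proof -
  obtain w where w: "w \<in> neighbors H (top_vertex H f)" and g: "g = f \<circ> Transposition.transpose (top_vertex H f) w"
    using assms(2) by (auto simp: slides_def)
  have "w \<in> W" using w neighbors_subset by blast
  then have "top_vertex H g = w" using swap_top(2)[OF assms(1)] g by simp
  moreover have "top_vertex H f \<in> neighbors H w"
    using w arcs_H_sym by (simp add: neighbors_def)
  moreover have "f = g \<circ> Transposition.transpose w (top_vertex H f)"
    by (simp add: g comp_assoc Transposition.transpose_commute[of w])
  ultimately show ?thesis by (auto simp: slides_def)
qed

section \<open>Connectivity of the graph of labellings\<close>

lemma sym_moves: "sym moves"
  using slides_sym slides_subset by (auto simp: moves_def intro!: symI)

lemma movesI:
  assumes "f \<in> labellings" and "f v = card W" and "(v, w) \<in> parcs H"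
  shows "(f, f \<circ> Transposition.transpose v w) \<in> moves" and "f \<circ> Transposition.transpose v w \<in> labellings"
    and "(f \<circ> Transposition.transpose v w) w = card W"
proof -
  have "top_vertex H f = v" using assms arcs_H_in_W by (intro top_vertex_eq) auto
  then show "(f, f \<circ> Transposition.transpose v w) \<in> moves"
    using assms by (auto simp: moves_def slides_def neighbors_def)
  then show "f \<circ> Transposition.transpose v w \<in> labellings" using slides_subset assms(1) by (auto simp: moves_def)
  show "(f \<circ> Transposition.transpose v w) w = card W" using assms(2) by simp
qed

text \<open>Moving the top label around a triangle through the root swaps the two other labels.\<close>

lemma swap_along_edge:
  assumes "f \<in> root_top_labellings" and "(u, v) \<in> parcs G"
  shows "(f, f \<circ> Transposition.transpose (Some u) (Some v)) \<in> moves\<^sup>*"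
proof -
  have arcs: "(None, Some u) \<in> parcs H" "(Some u, Some v) \<in> parcs H" "(Some v, None) \<in> parcs H"
    using assms(2) in_arcsD1[OF assms(2)] in_arcsD2[OF assms(2)] by (auto simp: add_root_def)
  have f: "f \<in> labellings" "f None = card W"
    using assms(1) by (auto simp: root_top_labellings_def)
  note m1 = movesI[OF f arcs(1)]
  note m2 = movesI[OF m1(2,3) arcs(2)]
  note m3 = movesI[OF m2(2,3) arcs(3)]
  have "u \<noteq> v"
    using assms(2) no_loops' by blast
  \<comment> \<open>With r for the root, this is the identity (r u)(u v)(v r) = (u v).\<close>
  then have "f \<circ> Transposition.transpose None (Some u) \<circ> Transposition.transpose (Some u) (Some v)
      \<circ> Transposition.transpose (Some v) None = f \<circ> Transposition.transpose (Some u) (Some v)"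
    by (auto simp: fun_eq_iff Transposition.transpose_def)
  moreover have "(f, f \<circ> Transposition.transpose None (Some u) \<circ> Transposition.transpose (Some u) (Some v)
      \<circ> Transposition.transpose (Some v) None) \<in> moves\<^sup>*"
    by (rule converse_rtrancl_into_rtrancl[OF m1(1)
          converse_rtrancl_into_rtrancl[OF m2(1) r_into_rtrancl[OF m3(1)]]])
  ultimately show ?thesis by simp
qed

text \<open>Conjugation along a path: (u w) = (u v)(v w)(u v). The induction hypothesis is applied
  to two different labellings, so \<open>f\<close> stays arbitrary.\<close>

lemma swap_connected:
  assumes "(u, v) \<in> (parcs G)\<^sup>*" and "u \<in> V" and "f \<in> root_top_labellings"
  shows "(f, f \<circ> Transposition.transpose (Some u) (Some v)) \<in> moves\<^sup>*"
  using assms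
proof (induction arbitrary: f)
  case (step v w)
  have perm: "Transposition.transpose (Some a) (Some b) permutes Some ` V" if "a \<in> V" "b \<in> V" for a b
    using that by (intro permutes_swap_id) auto
  have vw: "v \<in> V" "w \<in> V"
    using step.hyps(2) in_arcsD1 in_arcsD2 by auto
  have "v \<noteq> w" using step.hyps(2) no_loops' by blast
  show ?case
  proof (cases "u = w")
    \<comment> \<open>The conjugation formula needs distinct ends; if the path has returned to
      \<open>u\<close>, the target is \<open>f\<close> itself.\<close>
    case False
    let ?f1 = "f \<circ> Transposition.transpose (Some u) (Some v)"
    let ?f2 = "?f1 \<circ> Transposition.transpose (Some v) (Some w)"
    have f1: "?f1 \<in> root_top_labellings" using step.prems vw by (intro root_top_comp perm)
    have f2: "?f2 \<in> root_top_labellings" using f1 vw by (intro root_top_comp[OF f1] perm)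
    have "(f, ?f1) \<in> moves\<^sup>*" using step by blast
    moreover have "(?f1, ?f2) \<in> moves\<^sup>*" using f1 step.hyps(2) by (rule swap_along_edge)
    moreover have "(?f2, ?f2 \<circ> Transposition.transpose (Some u) (Some v)) \<in> moves\<^sup>*" using step f2 by blast
    moreover have "?f2 \<circ> Transposition.transpose (Some u) (Some v) = f \<circ> Transposition.transpose (Some u) (Some w)"
      using False \<open>v \<noteq> w\<close> by (auto simp: fun_eq_iff Transposition.transpose_def)
    ultimately show ?thesis by (metis rtrancl_trans)
  qed simp
qed simp

text \<open>Transpositions generate the symmetric group, and connectedness of \<open>G\<close> joins
  the two vertices of each by a path.\<close>

lemma permuted_connected:
  assumes "p permutes Some ` V" and "f \<in> root_top_labellings"
  shows "(f, f \<circ> p) \<in> moves\<^sup>*"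
proof -
  have "finite (Some ` V)" using finite_V by simp
  from this assms(1) show ?thesis
  proof (induction rule: permutes_rev_induct)
    case (swap a b p)
    then obtain u v where uv: "a = Some u" "b = Some v" "u \<in> V" "v \<in> V" by blast
    have "u \<rightarrow>\<^sup>*\<^bsub>with_proj G\<^esub> v"
      using graph_connected uv(3,4) reachable_mk_symmetric_eq[OF sym_arcs]
      by (simp add: Digraph_Component.connected_def strongly_connected_def)
    then have "(u, v) \<in> (parcs G)\<^sup>*"
      by (auto simp: reachable_conv)
    then have "(f \<circ> p, f \<circ> (p \<circ> Transposition.transpose a b)) \<in> moves\<^sup>*"
      using swap_connected[OF _ uv(3) root_top_comp[OF assms(2)]] swap.hyps by (simp add: uv comp_assoc)
    with swap.IH show ?case by (rule rtrancl_trans)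
  qed simp
qed

text \<open>The permutation is the inverse of \<open>f\<close> after \<open>g\<close>, extended by
  the identity off \<open>W\<close>. It fixes the root because both labellings put the top label
  there.\<close>

lemma root_top_permuted:
  assumes "f \<in> root_top_labellings" and "g \<in> root_top_labellings"
  obtains p where "p permutes Some ` V" and "g = f \<circ> p"
proof
  let ?p = "\<lambda>x. if x \<in> W then inv_into W f (g x) else x"
  have fg: "f \<in> labellings" "g \<in> labellings" "f None = card W" "g None = card W"
    using assms by (auto simp: root_top_labellings_def)
  note f = labelling_bij[OF fg(1)] and g = labelling_bij[OF fg(2)]
  have "bij_betw (inv_into W f \<circ> g) W W"
    using bij_betw_trans[OF g bij_betw_inv_into[OF f]] .
  then have "bij_betw ?p W W"
    by (rule bij_betw_cong[THEN iffD1, rotated]) simp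
  then have "?p permutes W"
    by (rule bij_imp_permutes) simp
  moreover have "?p None = None"
    using fg labelling_inj[OF fg(1)] None_in_W by (metis inv_into_f_f)
  ultimately show "?p permutes Some ` V"
    by (elim permutes_superset) (auto simp: W_eq)
  show "g = f \<circ> ?p"
  proof
    fix x show "g x = (f \<circ> ?p) x"
      using fg f labelling_range[OF fg(2)]
      by (cases "x \<in> W") (auto simp: labellings_def bij_betw_def f_inv_into_f simp del: atLeastAtMost_iff)
  qed
qed

text \<open>The root is adjacent to every other vertex, so at most one slide is needed.\<close>

lemma reach_root_top:
  assumes "f \<in> labellings"
  obtains g where "g \<in> root_top_labellings" and "(f, g) \<in> moves\<^sup>*"
proof (cases "top_vertex H f = None")
  case True
  then show ?thesis
    using that[of f] top_vertex[OF assms] assms by (auto simp: root_top_labellings_def)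
next
  case False
  then have "(top_vertex H f, None) \<in> parcs H"
    using top_vertex(1)[OF assms] by (auto simp: add_root_def)
  from movesI[OF assms top_vertex(2)[OF assms] this] show ?thesis
    by (intro that[of "f \<circ> Transposition.transpose (top_vertex H f) None"]) (auto simp: root_top_labellings_def)
qed

text \<open>Bring both top labels to the root, permute the labels on \<open>V\<close>, and reverse
  the second path by \<open>sym_moves\<close>.\<close>

lemma labellings_connected:
  assumes "f \<in> labellings" and "g \<in> labellings"
  shows "(f, g) \<in> moves\<^sup>*"
proof -
  obtain f' where f': "f' \<in> root_top_labellings" "(f, f') \<in> moves\<^sup>*"
    using reach_root_top[OF assms(1)] .
  obtain g' where g': "g' \<in> root_top_labellings" "(g, g') \<in> moves\<^sup>*"
    using reach_root_top[OF assms(2)] .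
  obtain p where "p permutes Some ` V" "g' = f' \<circ> p"
    using root_top_permuted[OF f'(1) g'(1)] .
  then have "(f', g') \<in> moves\<^sup>*"
    using permuted_connected f'(1) by blast
  moreover have "(g', g) \<in> moves\<^sup>*"
    using g'(2) sym_rtrancl[OF sym_moves] by (auto dest: symD)
  ultimately show ?thesis
    using f'(2) by (blast intro: rtrancl_trans)
qed

section \<open>Labellings with the top label at the root\<close>

lemma start_labelling: "f0 \<in> labellings"
  using start_bij by (simp add: labellings_def)

lemma root_top_subset: "root_top_labellings \<subseteq> labellings"
  by (auto simp: root_top_labellings_def)

lemma root_top_nonempty: "root_top_labellings \<noteq> {}"
  using reach_root_top[OF start_labelling] by blast

text \<open>Slides from these states correspond to the neighbours of the root; this is the constant
  degree that \<open>visits_ratio\<close> asks for.\<close>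

lemma card_slides_root_top: "f \<in> root_top_labellings \<Longrightarrow> card (slides f) = card V"
  using top_vertex_eq[of f None] None_in_W card_slides[of f]
  by (simp add: root_top_labellings_def neighbors_None card_image)

lemma card_root_top: "card root_top_labellings = fact (card V)"
proof -
  obtain f where f: "f \<in> root_top_labellings" using root_top_nonempty by blast
  then have inj: "inj_on f W" using labelling_inj root_top_subset by blast
  have "root_top_labellings = (\<lambda>p. f \<circ> p) ` {p. p permutes Some ` V}"
    using root_top_comp[OF f] root_top_permuted[OF f] by (auto simp: image_iff) metis
  moreover have "inj_on (\<lambda>p. f \<circ> p) {p. p permutes Some ` V}"
  proof (intro inj_onI ext)
    fix p q x assume pq: "p \<in> {p. p permutes Some ` V}" "q \<in> {p. p permutes Some ` V}" "f \<circ> p = f \<circ> q"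
    show "p x = q x"
    proof (cases "x \<in> Some ` V")
      case True
      then have "p x \<in> W" "q x \<in> W" using pq permutes_in_image[of _ "Some ` V" x] by (auto simp: W_eq)
      with inj pq(3) show ?thesis by (metis comp_apply inj_onD)
    qed (use pq in \<open>auto simp: permutes_not_in\<close>)
  qed
  ultimately show ?thesis
    using finite_V by (simp add: card_image card_permutations[OF card_image])
qed

sublocale walk: finite_random_walk labellings slides "slide H" "sliding_labelling H f0"
proof
  show "(f, g) \<in> {(x, y). x \<in> labellings \<and> y \<in> slides x}\<^sup>*"
    if "f \<in> labellings" "g \<in> labellings" for f g
    using labellings_connected[OF that] by (simp add: moves_def)
  show "slides f \<noteq> {}" if "f \<in> labellings" for f
    using top_vertex(1)[OF that] neighbors_nonempty by (simp add: slides_def)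
qed (use finite_labellings slides_subset slides_sym slide_eq start_labelling in auto)

section \<open>Orientations induced by labellings\<close>

lemma prob_sliding_orientation:
  "measure_pmf.prob (sliding_orientation G f0 t) X =
    measure_pmf.prob (sliding_labelling H f0 t) {f \<in> labellings. induced_orientation H f \<in> X}"
  \<comment> \<open>The walk stays in \<open>labellings\<close> almost surely, so the event may be
    cut down to a subset of the state space.\<close>
  unfolding sliding_orientation_def measure_map_pmf
  using walk.set_pmf_walk[of t]
  by (intro measure_pmf.finite_measure_eq_AE) (auto simp: AE_measure_pmf_iff)

lemma top_vertex_maximal:
  assumes "f \<in> labellings"
  shows "top_vertex H f \<in> maximal_elements W (generated_order W (induced_orientation H f))"
proof -
  have "y = top_vertex H f" if "(top_vertex H f, y) \<in> (induced_orientation H f)\<^sup>*" for y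
    using that
  proof (cases rule: converse_rtranclE)
    case (step z)
    then have "z \<in> W" "card W < f z"
      using arcs_H_in_W top_vertex(2)[OF assms] by (auto simp: induced_orientation_def)
    with labelling_le[OF assms] show ?thesis by fastforce
  qed simp
  then show ?thesis
    using top_vertex(1)[OF assms] by (auto simp: maximal_elements_def generated_order_def)
qed

text \<open>The top vertex is always maximal, so a root that is the only maximal element carries the
  top label. Conversely, every other vertex has an arc to a root labelled highest.\<close>

lemma induced_orientation_root_maximal_iff:
  assumes "f \<in> labellings"
  shows "induced_orientation H f \<in> root_maximal_orientations G \<longleftrightarrow> f None = card W"
proof
  assume "induced_orientation H f \<in> root_maximal_orientations G"
  then have "top_vertex H f = None"
    using top_vertex_maximal[OF assms] by (auto simp: root_maximal_orientations_def)
  then show "f None = card W"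
    using top_vertex(2)[OF assms] by simp
next
  let ?D = "induced_orientation H f"
  let ?M = "maximal_elements W (generated_order W ?D)"
  assume root: "f None = card W"
  then have "top_vertex H f = None"
    using top_vertex_eq[OF assms None_in_W] by blast
  then have "None \<in> ?M"
    using top_vertex_maximal[OF assms] by simp
  moreover have "x = None" if "x \<in> ?M" for x
  proof (rule ccontr)
    assume "x \<noteq> None"
    with that obtain v where v: "x = Some v" "v \<in> V"
      by (auto simp: maximal_elements_def W_eq)
    then have "Some v \<in> W" by (simp add: W_eq)
    then have "f (Some v) \<noteq> f None"
      using labelling_inj[OF assms] None_in_W by (auto dest: inj_onD)
    then have "(x, None) \<in> ?D"
      using v labelling_le[OF assms \<open>Some v \<in> W\<close>] root
      by (auto simp: induced_orientation_def add_root_def)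
    then have "(x, None) \<in> generated_order W ?D"
      using v \<open>Some v \<in> W\<close> None_in_W by (auto simp: generated_order_def)
    with that v None_in_W show False by (auto simp: maximal_elements_def)
  qed
  ultimately have "?M = {None}" by blast
  with acyclic_orientation_induced[OF pair_graph_add_root[OF graph] labelling_inj[OF assms]]
  show "?D \<in> root_maximal_orientations G" by (simp add: root_maximal_orientations_def)
qed

lemma root_maximal_preimage:
  "{f \<in> labellings. induced_orientation H f \<in> root_maximal_orientations G} = root_top_labellings"
  using induced_orientation_root_maximal_iff by (auto simp: root_top_labellings_def)

lemma orientation_preimage_subset:
  "D \<in> root_maximal_orientations G \<Longrightarrow> {f \<in> labellings. induced_orientation H f = D} \<subseteq> root_top_labellings"
  using induced_orientation_root_maximal_iff by (auto simp: root_top_labellings_def)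

text \<open>Hence all edges at the root point to it, and \<open>D\<close> is determined by its
  restriction to \<open>G\<close>.\<close>

lemma no_arc_from_root:
  assumes "D \<in> root_maximal_orientations G"
  shows "(None, y) \<notin> D"
proof -
  have ao: "acyclic_orientation H D"
    and "None \<in> maximal_elements W (generated_order W D)"
    using assms by (auto simp: root_maximal_orientations_def)
  then have max: "y = None" if "(None, y) \<in> D" "y \<in> W" for y
    using that None_in_W by (auto simp: maximal_elements_def generated_order_def)
  show ?thesis
  proof
    assume "(None, y) \<in> D"
    moreover from this ao have "(None, y) \<in> parcs H" by (auto simp: acyclic_orientation_def)
    ultimately have "y = None" using max arcs_H_in_W by blast
    with \<open>(None, y) \<in> parcs H\<close> show False by (auto simp: add_root_def)
  qed
qed

text \<open>Both orientations direct the root edges toward the root. On \<open>V\<close>, weak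
  monotonicity suffices because labels are distinct.\<close>

lemma induced_orientation_eq_iff:
  assumes D: "D \<in> root_maximal_orientations G" and f: "f \<in> root_top_labellings"
  shows "induced_orientation H f = D \<longleftrightarrow>
    (\<forall>(x, y) \<in> generated_order V (restrict_orientation G D). f (Some x) \<le> f (Some y))"
proof
  assume eq: "induced_orientation H f = D"
  have "f (Some x) \<le> f (Some y)" if "(x, y) \<in> (restrict_orientation G D)\<^sup>*" for x y
    using that
  proof induction
    case (step y z)
    then show ?case
      by (auto simp: restrict_orientation_def induced_orientation_def simp flip: eq)
  qed simp
  then show "\<forall>(x, y) \<in> generated_order V (restrict_orientation G D). f (Some x) \<le> f (Some y)"
    by (auto simp: generated_order_def)
next
  assume mono: "\<forall>(x, y) \<in> generated_order V (restrict_orientation G D). f (Some x) \<le> f (Some y)"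
  have lab: "f \<in> labellings" and root: "f None = card W"
    using f by (auto simp: root_top_labellings_def)
  have ao: "acyclic_orientation H D" using D by (simp add: root_maximal_orientations_def)
  have ai: "acyclic_orientation H (induced_orientation H f)"
    using acyclic_orientation_induced[OF pair_graph_add_root[OF graph] labelling_inj[OF lab]] .
  have sub: "(x, y) \<in> induced_orientation H f" if xy: "(x, y) \<in> D" for x y
  proof -
    have arc: "(x, y) \<in> parcs H" using xy ao by (auto simp: acyclic_orientation_def)
    then have "x \<in> W" "y \<in> W" "x \<noteq> y"
      using arcs_H_in_W rooted.no_loops' by blast+
    then have "f x \<noteq> f y" using labelling_inj[OF lab] by (auto dest: inj_onD)
    moreover have "f x \<le> f y"
    proof (cases y)
      case None
      then show ?thesis using labelling_le[OF lab \<open>x \<in> W\<close>] root by simp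
    next
      case (Some v)
      obtain u where "x = Some u" using xy no_arc_from_root[OF D] by (cases x) auto
      with Some xy arc \<open>x \<in> W\<close> \<open>y \<in> W\<close> have "(u, v) \<in> restrict_orientation G D" "u \<in> V" "v \<in> V"
        by (auto simp: restrict_orientation_def add_root_def)
      then have "(u, v) \<in> generated_order V (restrict_orientation G D)"
        by (auto simp: generated_order_def)
      with mono Some \<open>x = Some u\<close> show ?thesis by auto
    qed
    ultimately show ?thesis using arc by (simp add: induced_orientation_def)
  qed
  \<comment> \<open>One orientation inside another equals it: an arc missing from \<open>D\<close>
    would be reversed in \<open>D\<close>, and so in the induced orientation.\<close>
  moreover have "(x, y) \<in> D" if "(x, y) \<in> induced_orientation H f" for x y
  proof (rule ccontr)
    assume "(x, y) \<notin> D"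
    moreover have "(x, y) \<in> parcs H" using that by (simp add: induced_orientation_def)
    ultimately have "(y, x) \<in> D" using ao by (auto simp: acyclic_orientation_def)
    with sub[OF this] that show False by (auto simp: induced_orientation_def)
  qed
  ultimately show "induced_orientation H f = D" by auto
qed

text \<open>Restricting to \<open>V\<close> loses nothing: the root must carry the top label, and
  values off \<open>W\<close> are those of \<open>f0\<close>.\<close>

lemma card_orientation_preimage:
  assumes D: "D \<in> root_maximal_orientations G"
  shows "card {f \<in> labellings. induced_orientation H f = D}
    = num_linear_extensions G (restrict_orientation G D)"
proof -
  let ?P = "generated_order V (restrict_orientation G D)"
  let ?B = "{f \<in> labellings. induced_orientation H f = D}"
  let ?\<Phi> = "\<lambda>f. restrict (f \<circ> Some) V"
  have B: "f \<in> root_top_labellings" if "f \<in> ?B" for f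
    using that orientation_preimage_subset[OF D] by blast
  have "bij_betw ?\<Phi> ?B (linear_extensions V ?P)"
    unfolding bij_betw_def
  proof (intro conjI equalityI subsetI)
    show "inj_on ?\<Phi> ?B"
    proof (intro inj_onI ext)
      fix f g x assume fg: "f \<in> ?B" "g \<in> ?B" and eq: "?\<Phi> f = ?\<Phi> g"
      note top = B[OF fg(1)] B[OF fg(2)]
      show "f x = g x"
      proof (cases "x \<in> Some ` V")
        case True
        then obtain v where "x = Some v" "v \<in> V" by blast
        then show ?thesis using fun_cong[OF eq, of v] by simp
      next
        case False
        with top show ?thesis
          by (cases x) (auto simp: root_top_labellings_def labellings_def W_eq)
      qed
    qed
  next
    fix h assume "h \<in> ?\<Phi> ` ?B"
    then obtain f where h: "h = ?\<Phi> f" and f: "f \<in> ?B" by blast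
    have top: "f None = card W" and bij: "bij_betw f W {1..card W}"
      using B[OF f] by (auto simp: root_top_labellings_def labellings_def)
    have "bij_betw f (W - {None}) ({1..card W} - {card W})"
      using bij_betw_DiffI[OF bij, of "{None}" "{card W}"] top None_in_W card_W
      by (auto simp: bij_betw_def)
    moreover have "W - {None} = Some ` V" by (auto simp: W_eq)
    moreover have "{1..card W} - {card W} = {1..card V}" using card_W by auto
    ultimately have "bij_betw f (Some ` V) {1..card V}" by simp
    then have "bij_betw (f \<circ> Some) V {1..card V}"
      by (rule bij_betw_trans[rotated]) (auto simp: bij_betw_def)
    then have "bij_betw h V {1..card V}"
      unfolding h by (rule bij_betw_cong[THEN iffD1, rotated]) simp
    moreover have "\<forall>(x, y)\<in>?P. h x \<le> h y"
    proof -
      have "\<forall>(x, y)\<in>?P. f (Some x) \<le> f (Some y)"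
        using f induced_orientation_eq_iff[OF D B[OF f]] by blast
      moreover have "?P \<subseteq> V \<times> V" by (auto simp: generated_order_def)
      ultimately show ?thesis unfolding h by fastforce
    qed
    ultimately show "h \<in> linear_extensions V ?P"
      by (auto simp: linear_extensions_def h dest: bij_betwE)
  next
    fix h assume h: "h \<in> linear_extensions V ?P"
    then have bij: "bij_betw h V {1..card V}" and mono: "\<forall>(x, y)\<in>?P. h x \<le> h y"
      and ext: "h \<in> extensional V"
      by (auto simp: linear_extensions_def PiE_def)
    \<comment> \<open>The only possible preimage of \<open>h\<close>: the top label at the root, and
      \<open>f0\<close> off \<open>W\<close> as \<open>labellings\<close> requires.\<close>
    define f where "f = (\<lambda>x. case x of None \<Rightarrow> card W | Some v \<Rightarrow> if v \<in> V then h v else f0 x)"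
    have "bij_betw (h \<circ> the) (Some ` V) {1..card V}"
      using bij by (intro bij_betw_trans[of the _ V]) (auto simp: bij_betw_def inj_on_def image_iff)
    then have "bij_betw f (Some ` V) {1..card V}"
      by (rule bij_betw_cong[THEN iffD1, rotated]) (auto simp: f_def)
    then have "bij_betw f (insert None (Some ` V)) (insert (card W) {1..card V})"
      using notIn_Un_bij_betw[of None "Some ` V" f "{1..card V}"] card_W by (auto simp: f_def)
    moreover have "insert (card W) {1..card V} = {1..card W}" using card_W by auto
    ultimately have "bij_betw f W {1..card W}" by (simp add: W_eq)
    moreover have "f x = f0 x" if "x \<notin> W" for x
      using that by (cases x) (auto simp: f_def W_eq)
    ultimately have f: "f \<in> root_top_labellings"
      by (auto simp: root_top_labellings_def labellings_def f_def)
    have "\<forall>(x, y)\<in>?P. f (Some x) \<le> f (Some y)"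
    proof -
      have "?P \<subseteq> V \<times> V" by (auto simp: generated_order_def)
      with mono show ?thesis by (fastforce simp: f_def)
    qed
    then have "induced_orientation H f = D"
      using induced_orientation_eq_iff[OF D f] by blast
    with f have "f \<in> ?B" using root_top_subset by blast
    moreover have "h = ?\<Phi> f"
      using ext by (auto simp: fun_eq_iff f_def extensional_def)
    ultimately show "h \<in> ?\<Phi> ` ?B" by blast
  qed
  then show ?thesis
    by (simp add: num_linear_extensions_def bij_betw_same_card)
qed

end

theorem theorem5p8:
  fixes G :: "'a pair_pre_digraph" and n :: nat and f0 :: "'a option \<Rightarrow> nat"
  assumes "pair_graph G"
    and "Digraph_Component.connected (with_proj G)"
    and "card (pverts G) = n"
    and "bij_betw f0 (pverts (add_root G)) {1..n + 1}"
  shows "(\<Sum>t. ennreal (measure_pmf.prob (sliding_orientation G f0 (t + 1))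
           (root_maximal_orientations G))) = \<infinity>
    \<and> (\<forall>D \<in> root_maximal_orientations G.
      (\<lambda>N. (\<Sum>t=1..N. measure_pmf.prob (sliding_orientation G f0 t) {D}) /
            (\<Sum>t=1..N. measure_pmf.prob (sliding_orientation G f0 t) (root_maximal_orientations G)))
        \<longlonglongrightarrow> real (num_linear_extensions G (restrict_orientation G D)) / fact n)"
proof -
  have "card (pverts (add_root G)) = n + 1"
    using bij_betw_same_card[OF assms(4)] by simp
  then interpret rooted_sliding G f0
    using assms by (intro rooted_sliding.intro) simp_all
  note root = prob_sliding_orientation[of _ "root_maximal_orientations G", unfolded root_maximal_preimage]
  show ?thesis
  proof (intro conjI ballI)
    show "(\<Sum>t. ennreal (measure_pmf.prob (sliding_orientation G f0 (t + 1))
           (root_maximal_orientations G))) = \<infinity>"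
      unfolding root by (rule walk.suminf_prob[OF root_top_subset root_top_nonempty])
  next
    fix D assume D: "D \<in> root_maximal_orientations G"
    show "(\<lambda>N. (\<Sum>t=1..N. measure_pmf.prob (sliding_orientation G f0 t) {D}) /
            (\<Sum>t=1..N. measure_pmf.prob (sliding_orientation G f0 t) (root_maximal_orientations G)))
        \<longlonglongrightarrow> real (num_linear_extensions G (restrict_orientation G D)) / fact n"
      \<comment> \<open>The limit is the proportion of labellings inducing \<open>D\<close> among
        the \<open>n!\<close> with the top label at the root.\<close>
      using walk.visits_ratio[OF root_top_subset root_top_nonempty
          orientation_preimage_subset[OF D] card_slides_root_top]
      by (simp add: root prob_sliding_orientation[of _ "{D}"] card_orientation_preimage[OF D]
          card_root_top assms(3))
  qed
qed

end
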